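(* For twice differentiable functions, the DCP rule set (DCP Rules 1–4, listed in the context) is implied by the following positivity rules for $(n\times n)$-matrices: 1. If $c\geq 0$ and $M\succeq 0$, then $c\cdot M\succeq 0$. 2. If $c\leq 0$ and $M\preceq 0$, then $c\cdot M\succeq 0$. 3. If $M_1\succeq 0$ and $M_2\succeq 0$, then $M_1+M_2\succeq 0$. 4. If $M\succeq 0$ and $A$ is an arbitrary $(m\times n)$ matrix, then $AMA^\top\succeq 0$.
   Context: Matrices and scalars are real; $M\succeq 0$ means that $M$ is positive semidefinite and $M\preceq 0$ means that $M$ is negative semidefinite. For a twice differentiable function $h$ on $\mathbb{R}^n$, $H(h)$ denotes its Hessian. Convexity and concavity are treated through the Hessian: $h$ is convex if $H(h)\succeq 0$ and concave if $H(h)\preceq 0$, and conversely the Hessian of a convex (concave) function is positive (negative) semidefinite. "Implied" refers to this correspondence: the conclusions of the DCP rules about a function are obtained by applying the positivity rules to its Hessian. The disciplined convex programming (DCP) rule set comprises the following rules for functions on $\mathbb{R}^n$, where $f(g_1,g_2,\ldots,g_m)$ denotes the composition of a function $f$ of $m$ arguments with functions $g_1,\ldots,g_m$, and $[m]=\{1,\ldots,m\}$: DCP Rule 1. $\sum_{i=1}^m \alpha_i f_i$ is convex if either $\alpha_i\geq 0$ and $f_i$ is convex, or $\alpha_i\leq 0$ and $f_i$ is concave, for all $i\in[m]$. DCP Rule 2. $f(g_1,g_2,\ldots,g_m)$ is convex if $f$ is convex and for each $g_i$ one of the following conditions holds: (a) $f$ is increasing in argument $i$ and $g_i$ is convex;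 (b) $f$ is decreasing in argument $i$ and $g_i$ is concave; (c) $g_i$ is affine or constant. DCP Rule 3. $f(g_1,g_2,\ldots,g_m)$ is concave if $f$ is concave and for each $g_i$ one of the following conditions holds: (a) $f$ is increasing in argument $i$ and $g_i$ is concave; (b) $f$ is decreasing in argument $i$ and $g_i$ is convex; (c) $g_i$ is affine or constant. DCP Rule 4. $f(g_1,g_2,\ldots,g_m)$ is affine if $f$ is affine and each function $g_i$ is affine. Conventions: concavity of a function $f$ is certified by convexity of $-f$, so DCP Rule 3 is not considered separately. DCP Rule 4, whose conclusion (affinity) is a stronger property, is addressed by adding the rules $0\cdot M=M\cdot 0=0$ and $M+0=M$ to the positivity rules. *)

theory Defs
  imports "HOL-Analysis.Analysis"
begin

definition psd :: "real^'n^'n \<Rightarrow> bool" where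
  "psd M \<longleftrightarrow> transpose M = M \<and> (\<forall>x. 0 \<le> x \<bullet> (M *v x))"

definition nsd :: "real^'n^'n \<Rightarrow> bool" where
  "nsd M \<longleftrightarrow> transpose M = M \<and> (\<forall>x. x \<bullet> (M *v x) \<le> 0)"

definition grad :: "(real^'n \<Rightarrow> real) \<Rightarrow> real^'n \<Rightarrow> real^'n" where
  "grad h x = (\<chi> i. frechet_derivative h (at x) (axis i 1))"

definition twice_differentiable :: "(real^'n \<Rightarrow> real) \<Rightarrow> bool" where
  "twice_differentiable h \<longleftrightarrow>
     (\<forall>x. h differentiable (at x)) \<and> (\<forall>x. grad h differentiable (at x))"

definition hessian :: "(real^'n \<Rightarrow> real) \<Rightarrow> real^'n \<Rightarrow> real^'n^'n" where
  "hessian h x = jacobian (grad h) (at x)"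

definition affine_fun :: "(real^'n \<Rightarrow> real) \<Rightarrow> bool" where
  "affine_fun h \<longleftrightarrow> (\<exists>a b. \<forall>x. h x = a \<bullet> x + b)"

definition increasing_in :: "(real^'m \<Rightarrow> real) \<Rightarrow> 'm \<Rightarrow> bool" where
  "increasing_in f i \<longleftrightarrow>
     (\<forall>x y. (\<forall>j. j \<noteq> i \<longrightarrow> x $ j = y $ j) \<and> x $ i \<le> y $ i \<longrightarrow> f x \<le> f y)"

definition decreasing_in :: "(real^'m \<Rightarrow> real) \<Rightarrow> 'm \<Rightarrow> bool" where
  "decreasing_in f i \<longleftrightarrow>
     (\<forall>x y. (\<forall>j. j \<noteq> i \<longrightarrow> x $ j = y $ j) \<and> x $ i \<le> y $ i \<longrightarrow> f y \<le> f x)"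

definition compose_args :: "(real^'m \<Rightarrow> real) \<Rightarrow> ('m \<Rightarrow> real^'n \<Rightarrow> real) \<Rightarrow> real^'n \<Rightarrow> real" where
  "compose_args f g = (\<lambda>x. f (\<chi> i. g i x))"

text \<open>
  The four positivity rules, read as closure conditions on arbitrary judgements: \<open>P M\<close> stands for
  ``\<open>M\<close> is judged positive semidefinite'', \<open>N M\<close> for ``\<open>M\<close> is judged negative semidefinite'', both
  for (n x n)-matrices, and \<open>Q\<close> is the positivity judgement for (m x m)-matrices. A statement that
  holds for all judgements satisfying these conditions is one that follows from the rules alone,
  without any other property of semidefinite matrices. The additional rules \<open>0 \<cdot> M = M \<cdot> 0 = 0\<close> and
  \<open>M + 0 = M\<close> are equations between matrices and need no separate condition.
\<close>

definition positivity_rules ::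
  "(real^'n^'n \<Rightarrow> bool) \<Rightarrow> (real^'n^'n \<Rightarrow> bool) \<Rightarrow> (real^'m^'m \<Rightarrow> bool) \<Rightarrow> bool" where
  "positivity_rules P N Q \<longleftrightarrow>
     (\<forall>c M. 0 \<le> c \<and> P M \<longrightarrow> P (c *\<^sub>R M)) \<and>
     (\<forall>c M. c \<le> 0 \<and> N M \<longrightarrow> P (c *\<^sub>R M)) \<and>
     (\<forall>M\<^sub>1 M\<^sub>2. P M\<^sub>1 \<and> P M\<^sub>2 \<longrightarrow> P (M\<^sub>1 + M\<^sub>2)) \<and>
     (\<forall>M (A :: real^'n^'m). P M \<longrightarrow> Q (A ** M ** transpose A))"

text \<open>
  Since \<open>hessian (\<lambda>x. - h x) x = - hessian h x\<close>, this is the convention that concavity of \<open>h\<close> is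
  certified by convexity of \<open>- h\<close>.
\<close>

definition negation_convention ::
  "(real^'n^'n \<Rightarrow> bool) \<Rightarrow> (real^'n^'n \<Rightarrow> bool) \<Rightarrow> bool" where
  "negation_convention P N \<longleftrightarrow> (\<forall>M. N M \<longleftrightarrow> P (- M))"

text \<open>
  \<open>hessian_everywhere psd\<close>, \<open>hessian_everywhere nsd\<close> and \<open>hessian_everywhere (\<lambda>M. M = 0)\<close> are
  convexity, concavity and affinity as seen through the Hessian.
\<close>

definition hessian_everywhere :: "(real^'n^'n \<Rightarrow> bool) \<Rightarrow> (real^'n \<Rightarrow> real) \<Rightarrow> bool" where
  "hessian_everywhere J h \<longleftrightarrow> twice_differentiable h \<and> (\<forall>x. J (hessian h x))"

text \<open>
  The DCP rules for twice differentiable functions, relative to given notions of convex (\<open>cvx\<close>),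
  concave (\<open>ccv\<close>) and affine (\<open>aff\<close>) function on \<open>\<real>\<^sup>n\<close>, and \<open>cvx'\<close>, \<open>ccv'\<close>, \<open>aff'\<close> for the outer
  functions on \<open>\<real>\<^sup>m\<close>.
\<close>

definition dcp_rule1 ::
  "((real^'n \<Rightarrow> real) \<Rightarrow> bool) \<Rightarrow> ((real^'n \<Rightarrow> real) \<Rightarrow> bool) \<Rightarrow> bool" where
  "dcp_rule1 cvx ccv \<longleftrightarrow>
     (\<forall>(m::nat) (\<alpha> :: nat \<Rightarrow> real) (f :: nat \<Rightarrow> real^'n \<Rightarrow> real).
        1 \<le> m \<and>
        (\<forall>i\<in>{1..m}. twice_differentiable (f i) \<and>
           (0 \<le> \<alpha> i \<and> cvx (f i) \<or> \<alpha> i \<le> 0 \<and> ccv (f i)))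
        \<longrightarrow> cvx (\<lambda>x. \<Sum>i=1..m. \<alpha> i * f i x))"

definition dcp_rule2 ::
  "((real^'m \<Rightarrow> real) \<Rightarrow> bool) \<Rightarrow> ((real^'n \<Rightarrow> real) \<Rightarrow> bool) \<Rightarrow> ((real^'n \<Rightarrow> real) \<Rightarrow> bool) \<Rightarrow>
   ((real^'n \<Rightarrow> real) \<Rightarrow> bool) \<Rightarrow> bool" where
  "dcp_rule2 cvx' cvx ccv aff \<longleftrightarrow>
     (\<forall>(f :: real^'m \<Rightarrow> real) (g :: 'm \<Rightarrow> real^'n \<Rightarrow> real).
        twice_differentiable f \<and> (\<forall>i. twice_differentiable (g i)) \<and>
        cvx' f \<and>
        (\<forall>i. increasing_in f i \<and> cvx (g i)
           \<or> decreasing_in f i \<and> ccv (g i)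
           \<or> aff (g i) \<or> (\<exists>c. \<forall>x. g i x = c))
        \<longrightarrow> cvx (compose_args f g))"

definition dcp_rule3 ::
  "((real^'m \<Rightarrow> real) \<Rightarrow> bool) \<Rightarrow> ((real^'n \<Rightarrow> real) \<Rightarrow> bool) \<Rightarrow> ((real^'n \<Rightarrow> real) \<Rightarrow> bool) \<Rightarrow>
   ((real^'n \<Rightarrow> real) \<Rightarrow> bool) \<Rightarrow> bool" where
  "dcp_rule3 ccv' cvx ccv aff \<longleftrightarrow>
     (\<forall>(f :: real^'m \<Rightarrow> real) (g :: 'm \<Rightarrow> real^'n \<Rightarrow> real).
        twice_differentiable f \<and> (\<forall>i. twice_differentiable (g i)) \<and>
        ccv' f \<and>
        (\<forall>i. increasing_in f i \<and> ccv (g i)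
           \<or> decreasing_in f i \<and> cvx (g i)
           \<or> aff (g i) \<or> (\<exists>c. \<forall>x. g i x = c))
        \<longrightarrow> ccv (compose_args f g))"

definition dcp_rule4 ::
  "((real^'m \<Rightarrow> real) \<Rightarrow> bool) \<Rightarrow> ((real^'n \<Rightarrow> real) \<Rightarrow> bool) \<Rightarrow> bool" where
  "dcp_rule4 aff' aff \<longleftrightarrow>
     (\<forall>(f :: real^'m \<Rightarrow> real) (g :: 'm \<Rightarrow> real^'n \<Rightarrow> real).
        twice_differentiable f \<and> (\<forall>i. twice_differentiable (g i)) \<and>
        aff' f \<and> (\<forall>i. aff (g i))
        \<longrightarrow> aff (compose_args f g))"

definition dcp_rules ::
  "((real^'m \<Rightarrow> real) \<Rightarrow> bool) \<Rightarrow> ((real^'m \<Rightarrow> real) \<Rightarrow> bool) \<Rightarrow> ((real^'m \<Rightarrow> real) \<Rightarrow> bool) \<Rightarrow>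
   ((real^'n \<Rightarrow> real) \<Rightarrow> bool) \<Rightarrow> ((real^'n \<Rightarrow> real) \<Rightarrow> bool) \<Rightarrow> ((real^'n \<Rightarrow> real) \<Rightarrow> bool) \<Rightarrow> bool" where
  "dcp_rules cvx' ccv' aff' cvx ccv aff \<longleftrightarrow>
     dcp_rule1 cvx ccv \<and> dcp_rule2 cvx' cvx ccv aff \<and>
     dcp_rule3 ccv' cvx ccv aff \<and> dcp_rule4 aff' aff"

end

theory Submission
  imports Defs
begin

text \<open>
  The two constructions of the DCP rules have Hessians that are visibly assembled by the positivity
  rules. A linear combination has Hessian \<open>\<Sum>i. \<alpha>\<^sub>i H(f\<^sub>i)\<close>, and the chain rule applied twice
  (\<open>hessian_compose_args\<close>) gives
  \<open>H(f(g\<^sub>1,\<dots>,g\<^sub>m)) = A H(f) A\<^sup>T + \<Sum>i. (\<partial>\<^sub>i f) H(g\<^sub>i)\<close>,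
  where \<open>H(f)\<close> and \<open>\<partial>\<^sub>i f\<close> are taken at \<open>(g\<^sub>1,\<dots>,g\<^sub>m)\<close> and the columns of \<open>A\<close> are the gradients of
  the \<open>g\<^sub>i\<close>. The first term is positive by the congruence rule. Monotonicity of \<open>f\<close> in
  argument \<open>i\<close> fixes the sign of \<open>\<partial>\<^sub>i f\<close>, so the terms of the sum are positive by the two scaling
  rules, or zero if \<open>g\<^sub>i\<close> is affine. As only closure under the rules enters, this works for an
  arbitrary judgement \<open>P\<close> in place of positive semidefiniteness. Rule 3 is rule 2 for \<open>- f\<close>, and for
  rule 4 every term in the formula vanishes.

  It remains to connect Hessians with convexity. Restricting \<open>h\<close> to a line with direction \<open>d\<close> gives a
  real function with second derivative \<open>d\<^sup>T H(h) d\<close>, so convexity of \<open>h\<close> amounts to nonnegativity of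
  all these quadratic forms (\<open>convex_iff_hessian_psd\<close>). Semidefiniteness also demands that the
  Hessian be symmetric. Since the gradient is only assumed to be differentiable, with no continuity
  of second derivatives, symmetry is obtained from the limit of second difference quotients
  (\<open>hessian_symmetric\<close>). With these equivalences the DCP rules for convex functions are the instance
  \<open>P = psd\<close> of the abstract ones.
\<close>

section \<open>Calculus of gradients and Hessians\<close>

text \<open>
  The gradient is defined through partial derivatives; linearity of the Frechet derivative makes it
  represent the whole derivative.
\<close>
lemma twice_differentiable_derivatives:
  assumes "twice_differentiable h"
  shows "(h has_derivative (\<lambda>v. grad h x \<bullet> v)) (at x)"
    and "(grad h has_derivative (\<lambda>v. hessian h x *v v)) (at x)"
proof -
  let ?D = "frechet_derivative h (at x)"
  have D: "(h has_derivative ?D) (at x)"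
    using assms by (simp add: twice_differentiable_def frechet_derivative_works[symmetric])
  have "?D v = grad h x \<bullet> v" for v
  proof -
    have "?D v = ?D (\<Sum>i\<in>UNIV. v $ i *\<^sub>R axis i 1)"
      using basis_expansion[of v] by (simp add: scalar_mult_eq_scaleR)
    also have "\<dots> = (\<Sum>i\<in>UNIV. v $ i * ?D (axis i 1))"
      using has_derivative_linear[OF D] by (simp add: linear_sum linear_cmul)
    finally show ?thesis
      by (simp add: grad_def inner_vec_def mult.commute)
  qed
  then show "(h has_derivative (\<lambda>v. grad h x \<bullet> v)) (at x)"
    using D by presburger
  show "(grad h has_derivative (\<lambda>v. hessian h x *v v)) (at x)"
    using assms by (simp add: twice_differentiable_def hessian_def jacobian_works[symmetric])
qed

text \<open>
  The way in which all Hessians below are computed: by uniqueness of derivatives, candidates for the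
  gradient and the Hessian that satisfy the derivative relations are the gradient and the Hessian.
\<close>
lemma twice_differentiableI:
  fixes h :: "real^'n \<Rightarrow> real"
  assumes G: "\<And>x. (h has_derivative (\<lambda>v. G x \<bullet> v)) (at x)"
    and M: "\<And>x. (G has_derivative (\<lambda>v. M x *v v)) (at x)"
  shows "twice_differentiable h" "grad h = G" "hessian h = M"
proof -
  show grad: "grad h = G"
    by (simp add: grad_def fun_eq_iff vec_eq_iff inner_axis frechet_derivative_at[OF G, symmetric])
  show "twice_differentiable h"
    unfolding twice_differentiable_def grad using G M by (auto intro: differentiableI)
  have "frechet_derivative G (at x) = (*v) (M x)" for x
    using frechet_derivative_at[OF M] by presburger
  then show "hessian h = M"
    by (intro ext) (simp add: hessian_def grad jacobian_def)
qed

lemma matrix_vector_mult_sum_left: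
  fixes M :: "'k \<Rightarrow> real^'n^'m"
  shows "(\<Sum>i\<in>I. M i) *v v = (\<Sum>i\<in>I. M i *v v)"
  by (induction I rule: infinite_finite_induct) (simp_all add: matrix_vector_mult_add_rdistrib)

lemma hessian_linear_combination:
  fixes f :: "'k \<Rightarrow> real^'n \<Rightarrow> real"
  assumes "\<And>i. i \<in> I \<Longrightarrow> twice_differentiable (f i)"
  shows "twice_differentiable (\<lambda>x. \<Sum>i\<in>I. \<alpha> i * f i x)"
    and "hessian (\<lambda>x. \<Sum>i\<in>I. \<alpha> i * f i x) = (\<lambda>x. \<Sum>i\<in>I. \<alpha> i *\<^sub>R hessian (f i) x)"
proof -
  let ?G = "\<lambda>x. \<Sum>i\<in>I. \<alpha> i *\<^sub>R grad (f i) x"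
  have "((\<lambda>x. \<Sum>i\<in>I. \<alpha> i * f i x) has_derivative (\<lambda>v. \<Sum>i\<in>I. \<alpha> i * (grad (f i) x \<bullet> v))) (at x)" for x
    using assms twice_differentiable_derivatives(1)
    by (intro has_derivative_sum has_derivative_mult_right) auto
  then have 1: "((\<lambda>x. \<Sum>i\<in>I. \<alpha> i * f i x) has_derivative (\<lambda>v. ?G x \<bullet> v)) (at x)" for x
    by (simp add: inner_sum_left)
  have "(?G has_derivative (\<lambda>v. \<Sum>i\<in>I. \<alpha> i *\<^sub>R (hessian (f i) x *v v))) (at x)" for x
    using assms twice_differentiable_derivatives(2)
    by (intro has_derivative_sum has_derivative_scaleR_right) auto
  then have 2: "(?G has_derivative (\<lambda>v. (\<Sum>i\<in>I. \<alpha> i *\<^sub>R hessian (f i) x) *v v)) (at x)" for x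
    by (simp add: matrix_vector_mult_sum_left scaleR_matrix_vector_assoc)
  show "twice_differentiable (\<lambda>x. \<Sum>i\<in>I. \<alpha> i * f i x)"
    and "hessian (\<lambda>x. \<Sum>i\<in>I. \<alpha> i * f i x) = (\<lambda>x. \<Sum>i\<in>I. \<alpha> i *\<^sub>R hessian (f i) x)"
    using twice_differentiableI[OF 1 2] by blast+
qed

lemma hessian_uminus:
  assumes "twice_differentiable h"
  shows "twice_differentiable (\<lambda>x. - h x)" "hessian (\<lambda>x. - h x) = (\<lambda>x. - hessian h x)"
  using hessian_linear_combination[of "{()}" "\<lambda>_. h" "\<lambda>_. -1"] assms by simp_all

lemma twice_differentiable_uminus_iff:
  "twice_differentiable (\<lambda>x. - h x) \<longleftrightarrow> twice_differentiable h"
  using hessian_uminus(1)[of h] hessian_uminus(1)[of "\<lambda>x. - h x"] by auto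

lemma hessian_affine:
  "twice_differentiable (\<lambda>x. a \<bullet> x + b)" "hessian (\<lambda>x. a \<bullet> x + b) = (\<lambda>x. 0)"
proof -
  have 1: "((\<lambda>x. a \<bullet> x + b) has_derivative (\<lambda>v. a \<bullet> v)) (at x)" for x
    by (auto intro!: derivative_eq_intros)
  have 2: "((\<lambda>x. a) has_derivative (\<lambda>v. 0 *v v)) (at x)" for x :: "real^'n"
    by simp
  show "twice_differentiable (\<lambda>x. a \<bullet> x + b)" "hessian (\<lambda>x. a \<bullet> x + b) = (\<lambda>x. 0)"
    using twice_differentiableI[OF 1 2] by blast+
qed

lemma hessian_const: "hessian (\<lambda>x. c) = (\<lambda>x. 0)"
  using hessian_affine(2)[of 0 c] by simp

text \<open>
  The chain rule gives the gradient \<open>\<Sum>i. (\<partial>\<^sub>i f) grad g\<^sub>i = A (grad f)\<close>. In its derivative, the product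
  rule separates the part where the factors \<open>grad g\<^sub>i\<close> vary, which is the sum of scaled Hessians,
  from the part where \<open>grad f\<close> varies. The latter is \<open>A H(f) A\<^sup>T\<close>, since the derivative of
  \<open>x \<mapsto> (g\<^sub>1 x,\<dots>,g\<^sub>m x)\<close> is \<open>A\<^sup>T\<close>.
\<close>
lemma hessian_compose_args:
  fixes f :: "real^'m \<Rightarrow> real" and g :: "'m \<Rightarrow> real^'n \<Rightarrow> real"
  assumes f: "twice_differentiable f" and g: "\<And>i. twice_differentiable (g i)"
  defines "A \<equiv> \<lambda>x. (\<chi> k i. grad (g i) x $ k) :: real^'m^'n"
  shows "twice_differentiable (compose_args f g)"
    and "hessian (compose_args f g) = (\<lambda>x.
           A x ** hessian f (\<chi> i. g i x) ** transpose (A x)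
           + (\<Sum>i\<in>UNIV. grad f (\<chi> i. g i x) $ i *\<^sub>R hessian (g i) x))"
proof -
  define y where "y = (\<lambda>x. \<chi> i. g i x)"
  have A_mult: "A x *v w = (\<Sum>i\<in>UNIV. w $ i *\<^sub>R grad (g i) x)" for x w
    by (simp add: A_def matrix_vector_mult_def vec_eq_iff mult.commute)
  have A_transpose: "transpose (A x) *v v = (\<chi> i. grad (g i) x \<bullet> v)" for x v
    by (simp add: A_def vector_matrix_mult_def inner_vec_def vec_eq_iff mult.commute)
  have y: "(y has_derivative (\<lambda>v. transpose (A x) *v v)) (at x)" for x
  proof -
    have "((\<lambda>x. y x \<bullet> b) has_derivative (\<lambda>v. (\<chi> i. grad (g i) x \<bullet> v) \<bullet> b)) (at x)"
      if "b \<in> Basis" for b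
      using that twice_differentiable_derivatives(1)[OF g]
      by (auto simp: Basis_vec_def inner_axis y_def)
    then show ?thesis
      unfolding A_transpose by (subst has_derivative_componentwise_within) blast
  qed
  let ?G = "\<lambda>x. A x *v grad f (y x)"
  let ?M = "\<lambda>x. A x ** hessian f (y x) ** transpose (A x)
           + (\<Sum>i\<in>UNIV. grad f (y x) $ i *\<^sub>R hessian (g i) x)"
  have 1: "(compose_args f g has_derivative (\<lambda>v. ?G x \<bullet> v)) (at x)" for x
  proof -
    have "(compose_args f g has_derivative (\<lambda>v. grad f (y x) \<bullet> (transpose (A x) *v v))) (at x)"
      using diff_chain_at[OF y twice_differentiable_derivatives(1)[OF f]]
      by (simp add: compose_args_def y_def o_def)
    moreover have "w \<bullet> (transpose (A x) *v v) = (A x *v w) \<bullet> v" for w v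
      using dot_lmul_matrix[of w "transpose (A x)" v] by simp
    ultimately show ?thesis by simp
  qed
  have 2: "(?G has_derivative (\<lambda>v. ?M x *v v)) (at x)" for x
  proof -
    have "((\<lambda>x. grad f (y x)) has_derivative
            (\<lambda>v. hessian f (y x) *v (transpose (A x) *v v))) (at x)"
      using diff_chain_at[OF y twice_differentiable_derivatives(2)[OF f]] by (simp add: o_def)
    then have "((\<lambda>x. grad f (y x) $ i) has_derivative
            (\<lambda>v. (hessian f (y x) *v (transpose (A x) *v v)) $ i)) (at x)" for i
      by (rule bounded_linear.has_derivative[OF bounded_linear_vec_nth])
    then have "((\<lambda>x. \<Sum>i\<in>UNIV. grad f (y x) $ i *\<^sub>R grad (g i) x) has_derivative
           (\<lambda>v. \<Sum>i\<in>UNIV. grad f (y x) $ i *\<^sub>R (hessian (g i) x *v v)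
              + (hessian f (y x) *v (transpose (A x) *v v)) $ i *\<^sub>R grad (g i) x)) (at x)"
      by (intro has_derivative_sum has_derivative_scaleR twice_differentiable_derivatives(2) g)
    also have "(\<lambda>v. \<Sum>i\<in>UNIV. grad f (y x) $ i *\<^sub>R (hessian (g i) x *v v)
              + (hessian f (y x) *v (transpose (A x) *v v)) $ i *\<^sub>R grad (g i) x)
            = (\<lambda>v. ?M x *v v)"
      by (simp only: sum.distrib A_mult[symmetric] matrix_vector_mult_add_rdistrib
          matrix_vector_mul_assoc matrix_mul_assoc matrix_vector_mult_sum_left
          scaleR_matrix_vector_assoc[symmetric] add.commute)
    finally show ?thesis
      by (simp only: A_mult)
  qed
  show "twice_differentiable (compose_args f g)"
    and "hessian (compose_args f g) = (\<lambda>x.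
           A x ** hessian f (\<chi> i. g i x) ** transpose (A x)
           + (\<Sum>i\<in>UNIV. grad f (\<chi> i. g i x) $ i *\<^sub>R hessian (g i) x))"
    using twice_differentiableI[OF 1 2] unfolding y_def by blast+
qed

lemma grad_along_line:
  assumes "twice_differentiable h"
  shows "((\<lambda>t. h (a + t *\<^sub>R d)) has_real_derivative grad h (a + t *\<^sub>R d) \<bullet> d) (at t)"
proof -
  have "((\<lambda>t. a + t *\<^sub>R d) has_derivative (\<lambda>s. s *\<^sub>R d)) (at t)"
    by (auto intro!: derivative_eq_intros)
  from diff_chain_at[OF this twice_differentiable_derivatives(1)[OF assms]]
  show ?thesis
    by (simp add: o_def has_field_derivative_def mult.commute[of _ "_ \<bullet> _"])
qed

lemma hessian_along_line:
  assumes "twice_differentiable h"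
  shows "((\<lambda>t. grad h (a + t *\<^sub>R d) \<bullet> e) has_real_derivative (hessian h (a + t *\<^sub>R d) *v d) \<bullet> e) (at t)"
proof -
  have "((\<lambda>t. a + t *\<^sub>R d) has_derivative (\<lambda>s. s *\<^sub>R d)) (at t)"
    by (auto intro!: derivative_eq_intros)
  from has_derivative_inner_left[OF diff_chain_at[OF this twice_differentiable_derivatives(2)[OF assms]]]
  show ?thesis
    by (simp add: o_def has_field_derivative_def mult.commute[of _ "_ \<bullet> _"] matrix_vector_mult_scaleR)
qed

lemma grad_nonneg_if_increasing_in:
  assumes "twice_differentiable f" "increasing_in f i"
  shows "0 \<le> grad f y $ i"
proof -
  have "mono_on UNIV (\<lambda>t. f (y + t *\<^sub>R axis i 1))"
    using assms(2) by (auto simp: increasing_in_def axis_def intro!: mono_onI)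
  from mono_on_imp_deriv_nonneg[OF this grad_along_line[OF assms(1)], of 0]
  show ?thesis by (simp add: inner_axis)
qed

lemma grad_nonpos_if_decreasing_in:
  assumes "twice_differentiable f" "decreasing_in f i"
  shows "grad f y $ i \<le> 0"
proof -
  have "mono_on UNIV (\<lambda>t. - f (y + t *\<^sub>R axis i 1))"
    using assms(2) by (auto simp: decreasing_in_def axis_def intro!: mono_onI)
  from mono_on_imp_deriv_nonneg[OF this DERIV_minus[OF grad_along_line[OF assms(1)]], of 0]
  show ?thesis by (simp add: inner_axis)
qed

section \<open>The DCP rules from the positivity rules\<close>

text \<open>
  Terms that vanish are absorbed by \<open>M + 0 = M\<close>. The separate summand \<open>B\<close> keeps the sum nonempty:
  an abstract judgement closed under addition need not accept the zero matrix.
\<close>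
lemma sum_closed:
  assumes "finite I" "\<And>X Y. P X \<Longrightarrow> P Y \<Longrightarrow> P (X + Y)" "P B" "\<And>i. i \<in> I \<Longrightarrow> P (F i) \<or> F i = 0"
  shows "P (B + (\<Sum>i\<in>I. F i))"
  using assms(1,4)
proof (induction I rule: finite_induct)
  case empty
  then show ?case using assms(3) by simp
next
  case (insert i I)
  then have IH: "P (B + (\<Sum>i\<in>I. F i))" by blast
  have eq: "B + sum F (insert i I) = F i + (B + sum F I)"
    using insert.hyps by (simp add: add.left_commute)
  show ?case
    using insert.prems[of i] IH assms(2) unfolding eq by auto
qed

lemma dcp_rule1_from_positivity_rules:
  fixes P N :: "real^'n^'n \<Rightarrow> bool" and Q :: "real^'m^'m \<Rightarrow> bool"
  assumes rules: "positivity_rules P N Q"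
  shows "dcp_rule1 (hessian_everywhere P) (hessian_everywhere N)"
  unfolding dcp_rule1_def
proof (intro allI impI, elim conjE)
  fix m :: nat and \<alpha> :: "nat \<Rightarrow> real" and f :: "nat \<Rightarrow> real^'n \<Rightarrow> real"
  assume m: "1 \<le> m"
    and f: "\<forall>i\<in>{1..m}. twice_differentiable (f i) \<and>
      (0 \<le> \<alpha> i \<and> hessian_everywhere P (f i) \<or> \<alpha> i \<le> 0 \<and> hessian_everywhere N (f i))"
  have P: "P (\<alpha> i *\<^sub>R hessian (f i) x)" if "i \<in> {1..m}" for i x
    using f that rules unfolding positivity_rules_def hessian_everywhere_def by blast
  have add: "P (X + Y)" if "P X" "P Y" for X Y
    using rules that unfolding positivity_rules_def by blast
  \<comment> \<open>The bound \<open>1 \<le> m\<close> provides the first term as the summand that is always present.\<close>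
  have "P (\<alpha> 1 *\<^sub>R hessian (f 1) x + (\<Sum>i\<in>{1<..m}. \<alpha> i *\<^sub>R hessian (f i) x))" for x
    by (rule sum_closed[where P = P]) (use m P add in auto)
  moreover have "{1..m} = insert 1 {1<..m}"
    using m by auto
  ultimately have "P (\<Sum>i=1..m. \<alpha> i *\<^sub>R hessian (f i) x)" for x
    by simp
  moreover have "\<And>i. i \<in> {1..m} \<Longrightarrow> twice_differentiable (f i)"
    using f by blast
  ultimately show "hessian_everywhere P (\<lambda>x. \<Sum>i=1..m. \<alpha> i * f i x)"
    unfolding hessian_everywhere_def using hessian_linear_combination[of "{1..m}" f \<alpha>] by simp
qed

lemma dcp_rule2_from_positivity_rules:
  fixes P N :: "real^'n^'n \<Rightarrow> bool" and P' N' :: "real^'m^'m \<Rightarrow> bool"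
  assumes outer: "positivity_rules P' N' P" and inner: "positivity_rules P N P'"
  shows "dcp_rule2 (hessian_everywhere P') (hessian_everywhere P) (hessian_everywhere N)
           (hessian_everywhere (\<lambda>M. M = 0))"
  unfolding dcp_rule2_def
proof (intro allI impI, elim conjE)
  fix f :: "real^'m \<Rightarrow> real" and g :: "'m \<Rightarrow> real^'n \<Rightarrow> real"
  assume f: "twice_differentiable f" and g: "\<forall>i. twice_differentiable (g i)"
    and "hessian_everywhere P' f"
    and args: "\<forall>i. increasing_in f i \<and> hessian_everywhere P (g i)
           \<or> decreasing_in f i \<and> hessian_everywhere N (g i)
           \<or> hessian_everywhere (\<lambda>M. M = 0) (g i) \<or> (\<exists>c. \<forall>x. g i x = c)"
  \<comment> \<open>The congruence rule is the one that leads from judgements on \<open>\<real>\<^sup>m\<close> to judgements on \<open>\<real>\<^sup>n\<close>.\<close>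
  then have B: "P (A ** hessian f y ** transpose A)" for A :: "real^'m^'n" and y
    using outer unfolding positivity_rules_def hessian_everywhere_def by blast
  have F: "P (grad f y $ i *\<^sub>R hessian (g i) x) \<or> grad f y $ i *\<^sub>R hessian (g i) x = 0" for i x y
  proof -
    consider "increasing_in f i" "hessian_everywhere P (g i)"
      | "decreasing_in f i" "hessian_everywhere N (g i)"
      | "hessian_everywhere (\<lambda>M. M = 0) (g i)" | c where "\<forall>x. g i x = c"
      using args[rule_format, of i] by blast
    then show ?thesis
    proof cases
      case 1
      then have "P (hessian (g i) x)" and "0 \<le> grad f y $ i"
        using grad_nonneg_if_increasing_in[OF f] by (auto simp: hessian_everywhere_def)
      then show ?thesis
        using inner unfolding positivity_rules_def by blast
    next
      case 2
      then have "N (hessian (g i) x)" and "grad f y $ i \<le> 0"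
        using grad_nonpos_if_decreasing_in[OF f] by (auto simp: hessian_everywhere_def)
      then show ?thesis
        using inner unfolding positivity_rules_def by blast
    next
      case 3
      then show ?thesis
        by (simp add: hessian_everywhere_def)
    next
      case 4
      then have "g i = (\<lambda>x. c)"
        by blast
      then show ?thesis
        by (simp add: hessian_const)
    qed
  qed
  have add: "P (X + Y)" if "P X" "P Y" for X Y
    using inner that unfolding positivity_rules_def by blast
  show "hessian_everywhere P (compose_args f g)"
    unfolding hessian_everywhere_def
  proof (intro conjI allI)
    show "twice_differentiable (compose_args f g)"
      using f g by (simp add: hessian_compose_args)
    show "P (hessian (compose_args f g) x)" for x
      unfolding hessian_compose_args(2)[OF f g[rule_format]]
      by (rule sum_closed[where P = P, OF finite add B F])
  qed
qed

lemma concave_iff_uminus_convex: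
  assumes "negation_convention P N"
  shows "hessian_everywhere N h \<longleftrightarrow> hessian_everywhere P (\<lambda>x. - h x)"
  using assms hessian_uminus(2)[of h]
  unfolding hessian_everywhere_def negation_convention_def twice_differentiable_uminus_iff by auto

text \<open>
  Negating the outer function exchanges convex with concave and increasing with decreasing, and
  commutes with composition; this turns the hypotheses of rule 3 into those of rule 2.
\<close>
lemma dcp_rule3_from_dcp_rule2:
  fixes P N :: "real^'n^'n \<Rightarrow> bool" and P' N' :: "real^'m^'m \<Rightarrow> bool"
  assumes rule2: "dcp_rule2 (hessian_everywhere P') (hessian_everywhere P) (hessian_everywhere N) aff"
    and neg: "negation_convention P' N'" "negation_convention P N"
  shows "dcp_rule3 (hessian_everywhere N') (hessian_everywhere P) (hessian_everywhere N) aff"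
  unfolding dcp_rule3_def
proof (intro allI impI, elim conjE)
  fix f :: "real^'m \<Rightarrow> real" and g :: "'m \<Rightarrow> real^'n \<Rightarrow> real"
  assume f: "twice_differentiable f" and g: "\<forall>i. twice_differentiable (g i)"
    and N': "hessian_everywhere N' f"
    and args: "\<forall>i. increasing_in f i \<and> hessian_everywhere N (g i)
           \<or> decreasing_in f i \<and> hessian_everywhere P (g i)
           \<or> aff (g i) \<or> (\<exists>c. \<forall>x. g i x = c)"
  have inc: "increasing_in (\<lambda>x. - f x) i \<longleftrightarrow> decreasing_in f i"
    and dec: "decreasing_in (\<lambda>x. - f x) i \<longleftrightarrow> increasing_in f i" for i
    by (auto simp: increasing_in_def decreasing_in_def)
  have "hessian_everywhere P (compose_args (\<lambda>x. - f x) g)"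
  proof (rule rule2[unfolded dcp_rule2_def, rule_format], intro conjI allI)
    show "hessian_everywhere P' (\<lambda>x. - f x)"
      using N' concave_iff_uminus_convex[OF neg(1)] by blast
  qed (use f g args in \<open>auto simp: hessian_uminus inc dec\<close>)
  then show "hessian_everywhere N (compose_args f g)"
    unfolding concave_iff_uminus_convex[OF neg(2)] by (simp add: compose_args_def)
qed

lemma dcp_rule4_hessian:
  "dcp_rule4 (hessian_everywhere (\<lambda>M :: real^'m^'m. M = 0)) (hessian_everywhere (\<lambda>M :: real^'n^'n. M = 0))"
  by (auto simp: dcp_rule4_def hessian_everywhere_def hessian_compose_args)

lemma dcp_rules_from_positivity_rules:
  fixes P N :: "real^'n^'n \<Rightarrow> bool" and P' N' :: "real^'m^'m \<Rightarrow> bool"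
  assumes "positivity_rules P' N' P" "negation_convention P' N'"
    and "positivity_rules P N P'" "negation_convention P N"
  shows "dcp_rules
          (hessian_everywhere P') (hessian_everywhere N') (hessian_everywhere (\<lambda>M. M = 0))
          (hessian_everywhere P) (hessian_everywhere N) (hessian_everywhere (\<lambda>M. M = 0))"
  unfolding dcp_rules_def
  by (intro conjI dcp_rule1_from_positivity_rules[OF assms(3)]
      dcp_rule2_from_positivity_rules[OF assms(1,3)] dcp_rule4_hessian
      dcp_rule3_from_dcp_rule2[OF dcp_rule2_from_positivity_rules[OF assms(1,3)] assms(2,4)])

section \<open>Semidefinite matrices\<close>

lemma transpose_add: "transpose (A + B) = transpose A + transpose B"
  by (simp add: transpose_def vec_eq_iff)

lemma uminus_matrix_vector_mult: "(- M) *v x = - (M *v x)" for M :: "real^'n^'m"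
  using scaleR_matrix_vector_assoc[of "-1" M x] by simp

lemma transpose_uminus: "transpose (- M) = - transpose M"
  by (simp add: transpose_def vec_eq_iff)

lemma negation_convention_psd: "negation_convention psd nsd"
  by (simp add: negation_convention_def psd_def nsd_def uminus_matrix_vector_mult transpose_uminus)

text \<open>
  Only the congruence rule needs an idea: \<open>x\<^sup>T (A M A\<^sup>T) x\<close> is the quadratic form of \<open>M\<close> at \<open>A\<^sup>T x\<close>.
\<close>
lemma positivity_rules_psd: "positivity_rules (psd :: real^'n^'n \<Rightarrow> bool) nsd (psd :: real^'m^'m \<Rightarrow> bool)"
  unfolding positivity_rules_def
proof (intro conjI allI impI)
  fix M :: "real^'n^'n" and A :: "real^'n^'m"
  assume M: "psd M"
  have "x \<bullet> (A ** M ** transpose A *v x) = (transpose A *v x) \<bullet> (M *v (transpose A *v x))" for x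
    using dot_lmul_matrix[of x A]
    by (simp add: matrix_vector_mul_assoc[symmetric] del: matrix_vector_mul_assoc)
  then show "psd (A ** M ** transpose A)"
    using M by (simp add: psd_def matrix_transpose_mul matrix_mul_assoc)
qed (auto simp: psd_def nsd_def transpose_scalar transpose_add matrix_vector_mult_add_rdistrib
      scaleR_matrix_vector_assoc[symmetric] inner_add_right mult_nonneg_nonneg mult_nonpos_nonpos)

section \<open>Symmetry of the Hessian\<close>

text \<open>
  The mean value theorem, applied to \<open>r \<mapsto> h (x + t v + r u) - h (x + r u)\<close> on \<open>[0, t]\<close>, expresses the
  second difference as \<open>t\<close> times a difference of two values of \<open>grad h \<bullet> u\<close> at points within \<open>O(t)\<close>
  of \<open>x\<close>. Both values are replaced by their linear approximation at \<open>x\<close>; the linear parts differ by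
  \<open>t (H v) \<bullet> u\<close>, and the errors are \<open>o(t)\<close>.
\<close>
lemma second_difference_quotient:
  fixes h :: "real^'n \<Rightarrow> real"
  assumes h: "twice_differentiable h"
  shows "((\<lambda>t. (h (x + t *\<^sub>R u + t *\<^sub>R v) - h (x + t *\<^sub>R u) - h (x + t *\<^sub>R v) + h x) / t\<^sup>2)
           \<longlongrightarrow> (hessian h x *v v) \<bullet> u) (at_right 0)"
proof (rule tendstoI)
  fix e :: real assume e: "e > 0"
  let ?H = "hessian h x" and ?K = "norm u + norm v"
  \<comment> \<open>Two errors of size at most \<open>e' t (norm u + norm v)\<close>, each paired with \<open>u\<close>, must stay below \<open>t e\<close>.\<close>
  define e' where "e' = e / (2 * ?K * norm u + 1)"
  have pos: "2 * ?K * norm u + 1 > 0"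
    by (intro add_nonneg_pos mult_nonneg_nonneg) auto
  then have e': "e' > 0" "2 * ?K * norm u * e' < e"
    using e by (auto simp: e'_def field_simps)
  obtain d where d: "d > 0"
    and R: "\<And>y. norm (y - x) < d \<Longrightarrow> norm (grad h y - grad h x - ?H *v (y - x)) \<le> e' * norm (y - x)"
    using twice_differentiable_derivatives(2)[OF h, of x] e'(1)
    unfolding has_derivative_at_alt by blast
  \<comment> \<open>The bound on \<open>t\<close> keeps both of these points within distance \<open>d\<close> of \<open>x\<close>; adding 1 to the
      denominator covers \<open>u = v = 0\<close>.\<close>
  have bound: "dist ((h (x + t *\<^sub>R u + t *\<^sub>R v) - h (x + t *\<^sub>R u) - h (x + t *\<^sub>R v) + h x) / t\<^sup>2)
        ((?H *v v) \<bullet> u) < e" if t: "0 < t" "t < d / (?K + 1)" for t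
  proof -
    let ?\<phi> = "\<lambda>r. h (x + t *\<^sub>R v + r *\<^sub>R u) - h (x + r *\<^sub>R u)"
    have "\<exists>r. 0 < r \<and> r < t \<and> ?\<phi> t - ?\<phi> 0
      = (t - 0) * (grad h (x + t *\<^sub>R v + r *\<^sub>R u) \<bullet> u - grad h (x + r *\<^sub>R u) \<bullet> u)"
      by (rule MVT2[OF t(1)]) (intro DERIV_diff grad_along_line h)
    then obtain r where r: "0 < r" "r < t" and eq: "?\<phi> t - ?\<phi> 0
      = t * (grad h (x + t *\<^sub>R v + r *\<^sub>R u) \<bullet> u - grad h (x + r *\<^sub>R u) \<bullet> u)"
      by auto
    have "t * ?K < d"
    proof -
      have "t * (?K + 1) < d"
        using t by (simp add: pos_less_divide_eq add_nonneg_pos)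
      then show ?thesis using t(1) by (simp add: algebra_simps)
    qed
    have near: "norm (t *\<^sub>R v + r *\<^sub>R u) \<le> t * ?K" "norm (r *\<^sub>R u) \<le> t * ?K"
    proof -
      have "norm (r *\<^sub>R u) \<le> t * norm u"
        using r by (auto intro: mult_right_mono)
      moreover have "norm (t *\<^sub>R v + r *\<^sub>R u) \<le> norm (t *\<^sub>R v) + norm (r *\<^sub>R u)"
        by (rule norm_triangle_ineq)
      moreover have "norm (t *\<^sub>R v) = t * norm v" "0 \<le> t * norm v"
        using t by auto
      ultimately show "norm (t *\<^sub>R v + r *\<^sub>R u) \<le> t * ?K" "norm (r *\<^sub>R u) \<le> t * ?K"
        unfolding distrib_left by linarith+
    qed
    have remainder: "norm (grad h (x + w) - grad h x - ?H *v w) \<le> e' * (t * ?K)"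
      if "norm w \<le> t * ?K" for w
    proof -
      have "norm (grad h (x + w) - grad h x - ?H *v w) \<le> e' * norm w"
        using R[of "x + w"] that \<open>t * ?K < d\<close> by simp
      also have "\<dots> \<le> e' * (t * ?K)"
        using that e'(1) by simp
      finally show ?thesis .
    qed
    \<comment> \<open>The errors of the linear approximation at the two points supplied by the mean value theorem.\<close>
    let ?R1 = "grad h (x + (t *\<^sub>R v + r *\<^sub>R u)) - grad h x - ?H *v (t *\<^sub>R v + r *\<^sub>R u)"
    let ?R2 = "grad h (x + r *\<^sub>R u) - grad h x - ?H *v (r *\<^sub>R u)"
    have "?\<phi> t - ?\<phi> 0 - t\<^sup>2 * ((?H *v v) \<bullet> u) = t * ((?R1 - ?R2) \<bullet> u)"
      unfolding eq
      by (simp add: matrix_vector_right_distrib matrix_vector_mult_scaleR inner_diff_left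
          inner_add_left power2_eq_square algebra_simps)
    moreover have "\<bar>(?R1 - ?R2) \<bullet> u\<bar> \<le> t * (2 * ?K * norm u * e')"
    proof -
      have "\<bar>(?R1 - ?R2) \<bullet> u\<bar> \<le> norm (?R1 - ?R2) * norm u"
        by (rule Cauchy_Schwarz_ineq2)
      also have "\<dots> \<le> (e' * (t * ?K) + e' * (t * ?K)) * norm u"
        using norm_triangle_ineq4[of ?R1 ?R2] remainder[OF near(1)] remainder[OF near(2)]
        by (intro mult_right_mono) auto
      finally show ?thesis by (simp add: algebra_simps)
    qed
    ultimately have "\<bar>?\<phi> t - ?\<phi> 0 - t\<^sup>2 * ((?H *v v) \<bullet> u)\<bar> \<le> t * (t * (2 * ?K * norm u * e'))"
      using t(1) by (simp add: abs_mult del: distrib_left_numeral)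
    also have "\<dots> < t * (t * e)"
      using t(1) e'(2) by simp
    finally have "\<bar>?\<phi> t - ?\<phi> 0 - t\<^sup>2 * ((?H *v v) \<bullet> u)\<bar> / t\<^sup>2 < e"
      using t(1) by (simp add: pos_divide_less_eq power2_eq_square mult_ac)
    moreover have "(?\<phi> t - ?\<phi> 0) / t\<^sup>2 - (?H *v v) \<bullet> u = (?\<phi> t - ?\<phi> 0 - t\<^sup>2 * ((?H *v v) \<bullet> u)) / t\<^sup>2"
      using t(1) by (simp add: diff_divide_distrib)
    ultimately have "\<bar>(?\<phi> t - ?\<phi> 0) / t\<^sup>2 - (?H *v v) \<bullet> u\<bar> < e"
      by (simp only: abs_divide abs_power2)
    moreover have "?\<phi> t - ?\<phi> 0
        = h (x + t *\<^sub>R u + t *\<^sub>R v) - h (x + t *\<^sub>R u) - h (x + t *\<^sub>R v) + h x"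
      by (simp add: ac_simps)
    ultimately show ?thesis
      by (simp only: dist_real_def)
  qed
  show "eventually (\<lambda>t. dist ((h (x + t *\<^sub>R u + t *\<^sub>R v) - h (x + t *\<^sub>R u) - h (x + t *\<^sub>R v) + h x) / t\<^sup>2)
        ((?H *v v) \<bullet> u) < e) (at_right 0)"
    unfolding eventually_at_right_field
    using d bound by (intro exI[of _ "d / (?K + 1)"]) (auto intro!: divide_pos_pos add_nonneg_pos)
qed

text \<open>
  The second difference is symmetric in \<open>u\<close> and \<open>v\<close>, hence so is its limit.
\<close>
lemma hessian_symmetric:
  assumes "twice_differentiable h"
  shows "transpose (hessian h x) = hessian h x"
proof -
  have sym: "(hessian h x *v v) \<bullet> u = (hessian h x *v u) \<bullet> v" for u v
  proof (rule tendsto_unique[OF trivial_limit_at_right_real second_difference_quotient[OF assms]])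
    show "((\<lambda>t. (h (x + t *\<^sub>R u + t *\<^sub>R v) - h (x + t *\<^sub>R u) - h (x + t *\<^sub>R v) + h x) / t\<^sup>2)
           \<longlongrightarrow> (hessian h x *v u) \<bullet> v) (at_right 0)"
      using second_difference_quotient[OF assms, of x v u] by (simp add: algebra_simps)
  qed
  have "hessian h x $ i $ j = hessian h x $ j $ i" for i j
    using sym[of "axis j 1" "axis i 1"]
    by (simp add: inner_axis matrix_vector_mult_basis column_def)
  then show ?thesis
    by (simp add: transpose_def vec_eq_iff)
qed

section \<open>Convexity, concavity and affinity through the Hessian\<close>

lemma convex_iff_along_lines:
  "convex_on UNIV h \<longleftrightarrow> (\<forall>a d. convex_on UNIV (\<lambda>t::real. h (a + t *\<^sub>R d)))"
proof (intro iffI allI)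
  fix a d
  assume h: "convex_on UNIV h"
  show "convex_on UNIV (\<lambda>t::real. h (a + t *\<^sub>R d))"
  proof (rule convex_onI)
    fix t s r :: real assume t: "0 < t" "t < 1"
    have "a + ((1 - t) *\<^sub>R s + t *\<^sub>R r) *\<^sub>R d = (1 - t) *\<^sub>R (a + s *\<^sub>R d) + t *\<^sub>R (a + r *\<^sub>R d)"
      by (simp add: algebra_simps)
    then show "h (a + ((1 - t) *\<^sub>R s + t *\<^sub>R r) *\<^sub>R d)
        \<le> (1 - t) * h (a + s *\<^sub>R d) + t * h (a + r *\<^sub>R d)"
      using convex_onD[OF h, of t "a + s *\<^sub>R d" "a + r *\<^sub>R d"] t by simp
  qed simp
next
  assume lines: "\<forall>a d. convex_on UNIV (\<lambda>t::real. h (a + t *\<^sub>R d))"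
  show "convex_on UNIV h"
  proof (rule convex_onI)
    fix t :: real and x y assume t: "0 < t" "t < 1"
    have "h (x + t *\<^sub>R (y - x)) \<le> (1 - t) * h x + t * h y"
      using convex_onD[OF lines[rule_format, of x "y - x"], of t 0 1] t by simp
    moreover have "x + t *\<^sub>R (y - x) = (1 - t) *\<^sub>R x + t *\<^sub>R y"
      by (simp add: algebra_simps)
    ultimately show "h ((1 - t) *\<^sub>R x + t *\<^sub>R y) \<le> (1 - t) * h x + t * h y"
      by simp
  qed simp
qed

text \<open>
  For a convex function, adding the tangent inequalities at two points shows that the derivative is
  monotone, so its own derivative is nonnegative.
\<close>
lemma convex_on_real_iff_second_derivative_nonneg:
  fixes f :: "real \<Rightarrow> real"
  assumes f': "\<And>t. (f has_real_derivative f' t) (at t)"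
    and f'': "\<And>t. (f' has_real_derivative f'' t) (at t)"
  shows "convex_on UNIV f \<longleftrightarrow> (\<forall>t. 0 \<le> f'' t)"
proof
  assume convex: "convex_on UNIV f"
  have tangent: "f' s * (t - s) \<le> f t - f s" for s t
    using convex_on_imp_above_tangent[OF convex, of s t "f' s"] f' by simp
  have "mono_on UNIV f'"
  proof (rule mono_onI)
    fix s t :: real assume "s \<le> t"
    have "f' s * (t - s) \<le> f' t * (t - s)"
      using tangent[of s t] tangent[of t s] by (simp add: algebra_simps)
    then show "f' s \<le> f' t"
      using \<open>s \<le> t\<close> by (cases "s = t") auto
  qed
  then show "\<forall>t. 0 \<le> f'' t"
    using mono_on_imp_deriv_nonneg f'' by (metis UNIV_I interior_UNIV)
next
  assume "\<forall>t. 0 \<le> f'' t"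
  then show "convex_on UNIV f"
    using f' f'' by (intro f''_ge0_imp_convex) auto
qed

lemma convex_iff_hessian_psd:
  assumes h: "twice_differentiable h"
  shows "convex_on UNIV h \<longleftrightarrow> hessian_everywhere psd h"
proof -
  have "convex_on UNIV h \<longleftrightarrow> (\<forall>a d t. 0 \<le> (hessian h (a + t *\<^sub>R d) *v d) \<bullet> d)"
    by (simp only: convex_iff_along_lines[of h] convex_on_real_iff_second_derivative_nonneg[OF
          grad_along_line[OF h] hessian_along_line[OF h]])
  also have "\<dots> \<longleftrightarrow> (\<forall>x d. 0 \<le> d \<bullet> (hessian h x *v d))"
  proof (intro iffI allI)
    fix x d
    assume "\<forall>a d t. 0 \<le> (hessian h (a + t *\<^sub>R d) *v d) \<bullet> d"
    from this[rule_format, of x 0 d] show "0 \<le> d \<bullet> (hessian h x *v d)"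
      by (simp add: inner_commute)
  qed (simp add: inner_commute)
  finally show ?thesis
    by (simp add: hessian_everywhere_def psd_def h hessian_symmetric)
qed

lemma concave_iff_hessian_nsd:
  assumes "twice_differentiable h"
  shows "concave_on UNIV h \<longleftrightarrow> hessian_everywhere nsd h"
  using convex_iff_hessian_psd[OF hessian_uminus(1)[OF assms]]
    concave_iff_uminus_convex[OF negation_convention_psd, of h]
  by (simp add: concave_on_def)

text \<open>
  A vanishing Hessian makes the gradient a constant \<open>a\<close>, and then \<open>h x - a \<bullet> x\<close> has derivative zero.
\<close>
lemma affine_iff_hessian_zero:
  assumes h: "twice_differentiable h"
  shows "affine_fun h \<longleftrightarrow> hessian_everywhere (\<lambda>M. M = 0) h"
proof
  assume "affine_fun h"
  then obtain a b where "h = (\<lambda>x. a \<bullet> x + b)"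
    by (auto simp: affine_fun_def)
  then show "hessian_everywhere (\<lambda>M. M = 0) h"
    by (simp add: hessian_everywhere_def hessian_affine)
next
  assume "hessian_everywhere (\<lambda>M. M = 0) h"
  then have "(grad h has_derivative (\<lambda>v. 0)) (at x)" for x
    using twice_differentiable_derivatives(2)[OF h, of x] by (simp add: hessian_everywhere_def)
  then obtain a where a: "\<And>x. grad h x = a"
    using has_derivative_zero_constant[of UNIV "grad h"] by auto
  have "((\<lambda>x. h x - a \<bullet> x) has_derivative (\<lambda>v. 0)) (at x)" for x
    using twice_differentiable_derivatives(1)[OF h, of x]
    by (auto intro!: derivative_eq_intros simp: a)
  then obtain b where "\<And>x. h x - a \<bullet> x = b"
    using has_derivative_zero_constant[of UNIV "\<lambda>x. h x - a \<bullet> x"] by auto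
  then have "\<forall>x. h x = a \<bullet> x + b"
    by (metis add.commute diff_add_cancel)
  then show "affine_fun h"
    unfolding affine_fun_def by blast
qed

text \<open>
  All functions in the hypotheses of the rules are twice differentiable, so the rules stated through
  Hessians translate; for the conclusions, \<open>hessian_everywhere\<close> itself contains the differentiability.
\<close>
lemma dcp_rules_convex:
  "dcp_rules
     (convex_on UNIV :: (real^'m \<Rightarrow> real) \<Rightarrow> bool) (concave_on UNIV) affine_fun
     (convex_on UNIV :: (real^'n \<Rightarrow> real) \<Rightarrow> bool) (concave_on UNIV) affine_fun"
proof -
  note iffs = convex_iff_hessian_psd concave_iff_hessian_nsd affine_iff_hessian_zero
  have dcp: "dcp_rules
     (hessian_everywhere (psd :: real^'m^'m \<Rightarrow> bool)) (hessian_everywhere nsd) (hessian_everywhere (\<lambda>M. M = 0))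
     (hessian_everywhere (psd :: real^'n^'n \<Rightarrow> bool)) (hessian_everywhere nsd) (hessian_everywhere (\<lambda>M. M = 0))"
    by (intro dcp_rules_from_positivity_rules positivity_rules_psd negation_convention_psd)
  have from_hessian: "hessian_everywhere psd h \<Longrightarrow> convex_on UNIV h" for h :: "real^'n \<Rightarrow> real"
    using convex_iff_hessian_psd[of h] by (auto simp: hessian_everywhere_def)
  have 1: "dcp_rule1 (convex_on UNIV :: (real^'n \<Rightarrow> real) \<Rightarrow> bool) (concave_on UNIV)"
    using dcp unfolding dcp_rules_def dcp_rule1_def
    by (simp add: iffs from_hessian cong: conj_cong)
  have "dcp_rule2 (convex_on UNIV :: (real^'m \<Rightarrow> real) \<Rightarrow> bool)
     (convex_on UNIV :: (real^'n \<Rightarrow> real) \<Rightarrow> bool) (concave_on UNIV) affine_fun"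
    using dcp unfolding dcp_rules_def dcp_rule2_def
    by (simp add: iffs hessian_compose_args cong: conj_cong)
  moreover have "dcp_rule3 (concave_on UNIV :: (real^'m \<Rightarrow> real) \<Rightarrow> bool)
     (convex_on UNIV :: (real^'n \<Rightarrow> real) \<Rightarrow> bool) (concave_on UNIV) affine_fun"
    using dcp unfolding dcp_rules_def dcp_rule3_def
    by (simp add: iffs hessian_compose_args cong: conj_cong)
  moreover have "dcp_rule4 (affine_fun :: (real^'m \<Rightarrow> real) \<Rightarrow> bool)
     (affine_fun :: (real^'n \<Rightarrow> real) \<Rightarrow> bool)"
    using dcp unfolding dcp_rules_def dcp_rule4_def
    by (simp add: iffs hessian_compose_args cong: conj_cong)
  ultimately show ?thesis
    using 1 unfolding dcp_rules_def by blast
qed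

theorem proposition1:
  shows
    "(\<forall>(P' :: real^'m^'m \<Rightarrow> bool) N' (P :: real^'n^'n \<Rightarrow> bool) N.
        positivity_rules P' N' P \<and> negation_convention P' N' \<and>
        positivity_rules P N P' \<and> negation_convention P N \<longrightarrow>
        dcp_rules
          (hessian_everywhere P') (hessian_everywhere N') (hessian_everywhere (\<lambda>M. M = 0))
          (hessian_everywhere P) (hessian_everywhere N) (hessian_everywhere (\<lambda>M. M = 0))) \<and>
     positivity_rules (psd :: real^'n^'n \<Rightarrow> bool) nsd (psd :: real^'m^'m \<Rightarrow> bool) \<and>
     negation_convention (psd :: real^'n^'n \<Rightarrow> bool) nsd \<and>
     (\<forall>h :: real^'n \<Rightarrow> real. twice_differentiable h \<longrightarrow>
        (convex_on UNIV h \<longleftrightarrow> hessian_everywhere psd h) \<and>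
        (concave_on UNIV h \<longleftrightarrow> hessian_everywhere nsd h) \<and>
        (affine_fun h \<longleftrightarrow> hessian_everywhere (\<lambda>M. M = 0) h)) \<and>
     dcp_rules
       (convex_on UNIV :: (real^'m \<Rightarrow> real) \<Rightarrow> bool) (concave_on UNIV) affine_fun
       (convex_on UNIV :: (real^'n \<Rightarrow> real) \<Rightarrow> bool) (concave_on UNIV) affine_fun"
proof (intro conjI allI impI)
  fix P' :: "real^'m^'m \<Rightarrow> bool" and N' and P :: "real^'n^'n \<Rightarrow> bool" and N
  assume "positivity_rules P' N' P \<and> negation_convention P' N' \<and>
    positivity_rules P N P' \<and> negation_convention P N"
  then show "dcp_rules
      (hessian_everywhere P') (hessian_everywhere N') (hessian_everywhere (\<lambda>M. M = 0))
      (hessian_everywhere P) (hessian_everywhere N) (hessian_everywhere (\<lambda>M. M = 0))"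
    using dcp_rules_from_positivity_rules by blast
qed (simp_all add: positivity_rules_psd negation_convention_psd dcp_rules_convex
      convex_iff_hessian_psd concave_iff_hessian_nsd affine_iff_hessian_zero)

end
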